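(* Let $E,E'$ be finite-dimensional real normed vector spaces, let $U\subset E$ and $U'\subset E'$ be open subsets, and let $f:U\to U'$ be a map which is G-differentiable at every point of $U$ and such that the map $\mathrm{k}_+f:U\to\mathbb{L}\mathrm{Hom}(E,E')$, $x\mapsto \mathrm{k}_+f_x$, is continuous on $U$. Then $f$ is of class $C^1$.
   Context: For real normed vector spaces $E,E'$, $\mathbb{L}\mathrm{Hom}(E,E')$ denotes the vector space of all Lipschitz maps $h:E\to E'$ such that $h(tx)=th(x)$ for all real $t\ge 0$ and $x\in E$ (such $h$ need not be linear). It is normed by $\|h\|=\sup\{C(x)\mid \|x\|\le 1\}$, where $C(x)=\|h(x)\|/\|x\|$ if $x\ne0$ and $C(0)=0$. Let $U\subset E$, $U'\subset E'$ be open and $a\in U$. A map $f:U\to U'$ is G-differentiable at $a$ if there exists $h\in\mathbb{L}\mathrm{Hom}(E,E')$ such that $f$ is tangent at $a$ to the restriction to $U$ of the map $x\mapsto f(a)+h(x-a)$, i.e. $\forall\varepsilon>0\ \exists\eta>0\ \forall x\in U\ (\|x-a\|\le\eta\Rightarrow\|f(x)-f(a)-h(x-a)\|\le\varepsilon\|x-a\|)$. Such an $h$ is unique and is denoted $\mathrm{k}_+f_a$. *)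

theory Defs
  imports "HOL-Analysis.Analysis"
begin

text \<open>The space of Lipschitz, positively homogeneous (not necessarily linear) maps.\<close>

typedef (overloaded) ('a, 'b) lhom =
  "{h :: 'a::real_normed_vector \<Rightarrow> 'b::real_normed_vector.
      (\<exists>L. L-lipschitz_on UNIV h) \<and> (\<forall>t x. 0 \<le> t \<longrightarrow> h (t *\<^sub>R x) = t *\<^sub>R h x)}"
  morphisms lhom_apply Lhom
  by (rule exI[of _ "\<lambda>_. 0"]) (auto intro: lipschitz_on_constant)

declare [[coercion "lhom_apply :: ('a::real_normed_vector, 'b::real_normed_vector) lhom \<Rightarrow> 'a \<Rightarrow> 'b"]]

setup_lifting type_definition_lhom

lemma lhom_eqI: "(\<And>x. lhom_apply g x = lhom_apply h x) \<Longrightarrow> g = h"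
  by transfer auto

lemma lhom_lipschitz: "\<exists>L. L-lipschitz_on UNIV (lhom_apply h)"
  by transfer auto

lemma lhom_scaleR: "0 \<le> t \<Longrightarrow> lhom_apply h (t *\<^sub>R x) = t *\<^sub>R lhom_apply h x"
  by transfer auto

lemma lhom_apply_0 [simp]: "lhom_apply h 0 = 0"
  using lhom_scaleR[of 0 h 0] by simp

definition lhom_quot :: "('a::real_normed_vector, 'b::real_normed_vector) lhom \<Rightarrow> 'a \<Rightarrow> real"
  where "lhom_quot h x = (if x = 0 then 0 else norm (lhom_apply h x) / norm x)"

lemma lhom_quot_nonneg: "0 \<le> lhom_quot h x"
  by (simp add: lhom_quot_def)

lemma lhom_quot_bdd: "bdd_above {lhom_quot h x | x. norm x \<le> 1}"
proof -
  obtain L where L: "L-lipschitz_on UNIV (lhom_apply h)"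
    using lhom_lipschitz by blast
  have "lhom_quot h x \<le> L" for x
  proof (cases "x = 0")
    case True
    then show ?thesis using lipschitz_on_nonneg[OF L] by (simp add: lhom_quot_def)
  next
    case False
    have "norm (lhom_apply h x) \<le> L * norm x"
      using lipschitz_on_normD[OF L, of x 0] by simp
    with False show ?thesis by (simp add: lhom_quot_def divide_le_eq)
  qed
  then show ?thesis by (auto simp: bdd_above_def)
qed

instantiation lhom :: (real_normed_vector, real_normed_vector) real_normed_vector
begin

definition norm_lhom :: "('a, 'b) lhom \<Rightarrow> real"
  where "norm_lhom h = Sup {lhom_quot h x | x. norm x \<le> 1}"

lift_definition zero_lhom :: "('a, 'b) lhom" is "\<lambda>x. 0"
  by (auto intro: lipschitz_on_constant)

lift_definition plus_lhom :: "('a, 'b) lhom \<Rightarrow> ('a, 'b) lhom \<Rightarrow> ('a, 'b) lhom"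
  is "\<lambda>g h x. g x + h x"
  by (auto intro: lipschitz_on_add simp: scaleR_add_right)

lift_definition minus_lhom :: "('a, 'b) lhom \<Rightarrow> ('a, 'b) lhom \<Rightarrow> ('a, 'b) lhom"
  is "\<lambda>g h x. g x - h x"
  by (auto intro: lipschitz_on_diff simp: scaleR_diff_right)

lift_definition uminus_lhom :: "('a, 'b) lhom \<Rightarrow> ('a, 'b) lhom" is "\<lambda>h x. - h x"
  by auto

lift_definition scaleR_lhom :: "real \<Rightarrow> ('a, 'b) lhom \<Rightarrow> ('a, 'b) lhom"
  is "\<lambda>r h x. r *\<^sub>R h x"
  by (auto intro: lipschitz_on_cmult)

definition dist_lhom :: "('a, 'b) lhom \<Rightarrow> ('a, 'b) lhom \<Rightarrow> real"
  where "dist_lhom g h = norm (g - h)"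

definition sgn_lhom :: "('a, 'b) lhom \<Rightarrow> ('a, 'b) lhom"
  where "sgn_lhom h = inverse (norm h) *\<^sub>R h"

definition uniformity_lhom :: "(('a, 'b) lhom \<times> ('a, 'b) lhom) filter"
  where "uniformity_lhom = (INF e\<in>{0 <..}. principal {(g, h). dist g h < e})"

definition open_lhom :: "('a, 'b) lhom set \<Rightarrow> bool"
  where "open_lhom S = (\<forall>g\<in>S. \<forall>\<^sub>F (g', h) in uniformity. g' = g \<longrightarrow> h \<in> S)"

lemma lhom_quot_le_norm: "norm x \<le> 1 \<Longrightarrow> lhom_quot h x \<le> norm h"
  unfolding norm_lhom_def by (rule cSup_upper[OF _ lhom_quot_bdd]) auto

lemma norm_lhom_le: "(\<And>x. norm x \<le> 1 \<Longrightarrow> lhom_quot h x \<le> B) \<Longrightarrow> norm h \<le> B"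
  unfolding norm_lhom_def
  by (rule cSup_least) (auto intro: exI[of _ 0])

lemma norm_lhom_nonneg: "0 \<le> norm (h :: ('a, 'b) lhom)"
  using lhom_quot_le_norm[of 0 h] lhom_quot_nonneg[of h 0] by simp

lemma norm_lhom_apply: "norm (lhom_apply h x) \<le> norm h * norm x"
proof (cases "x = 0")
  case False
  have "lhom_quot h (inverse (norm x) *\<^sub>R x) = norm (lhom_apply h x) / norm x"
    using False by (simp add: lhom_quot_def lhom_scaleR divide_inverse_commute)
  moreover have "lhom_quot h (inverse (norm x) *\<^sub>R x) \<le> norm h"
    using False by (intro lhom_quot_le_norm) simp
  ultimately show ?thesis using False by (simp add: divide_le_eq)
qed simp

lemma norm_lhom_leI:
  assumes "0 \<le> B" "\<And>x. norm (lhom_apply h x) \<le> B * norm x"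
  shows "norm h \<le> B"
  using assms by (intro norm_lhom_le) (auto simp: lhom_quot_def divide_le_eq)

lemma norm_lhom_scaleR_le: "norm (r *\<^sub>R h) \<le> \<bar>r\<bar> * norm (h :: ('a, 'b) lhom)"
  by (rule norm_lhom_leI)
    (auto simp: norm_lhom_nonneg scaleR_lhom.rep_eq mult.assoc
      intro!: mult_left_mono norm_lhom_apply)

instance
proof
  fix g h k :: "('a, 'b) lhom" and r s :: real
  show "dist g h = norm (g - h)" by (rule dist_lhom_def)
  show "g + h + k = g + (h + k)" by transfer (simp add: add.assoc)
  show "g + h = h + g" by transfer (simp add: add.commute)
  show "0 + g = g" by transfer simp
  show "- g + g = 0" by transfer simp
  show "g - h = g + - h" by transfer simp
  show "r *\<^sub>R (g + h) = r *\<^sub>R g + r *\<^sub>R h" by transfer (simp add: scaleR_add_right)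
  show "(r + s) *\<^sub>R g = r *\<^sub>R g + s *\<^sub>R g" by transfer (simp add: scaleR_add_left)
  show "r *\<^sub>R s *\<^sub>R g = (r * s) *\<^sub>R g" by transfer simp
  show "1 *\<^sub>R g = g" by transfer simp
  show "sgn g = inverse (norm g) *\<^sub>R g" by (rule sgn_lhom_def)
  show "(uniformity :: (('a, 'b) lhom \<times> ('a, 'b) lhom) filter) =
      (INF e\<in>{0 <..}. principal {(x, y). dist x y < e})"
    by (rule uniformity_lhom_def)
  show "open U = (\<forall>x\<in>U. \<forall>\<^sub>F (x', y) in uniformity. x' = x \<longrightarrow> y \<in> U)"
    for U :: "('a, 'b) lhom set"
    by (rule open_lhom_def)
  show "(norm g = 0) = (g = 0)"
  proof
    assume "norm g = 0"
    then have "lhom_apply g x = 0" for x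
      using norm_lhom_apply[of g x] by simp
    then show "g = 0" by (intro lhom_eqI) (simp add: zero_lhom.rep_eq)
  next
    assume "g = 0"
    then have "norm g \<le> 0" by (intro norm_lhom_leI) (auto simp: zero_lhom.rep_eq)
    then show "norm g = 0" using norm_lhom_nonneg[of g] by simp
  qed
  show "norm (g + h) \<le> norm g + norm h"
  proof (rule norm_lhom_leI)
    show "norm (lhom_apply (g + h) x) \<le> (norm g + norm h) * norm x" for x
      using norm_triangle_ineq[of "lhom_apply g x" "lhom_apply h x"]
        norm_lhom_apply[of g x] norm_lhom_apply[of h x]
      by (simp add: plus_lhom.rep_eq distrib_right)
  qed (simp add: norm_lhom_nonneg)
  show "norm (r *\<^sub>R g) = \<bar>r\<bar> * norm g"
  proof (rule antisym[OF norm_lhom_scaleR_le])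
    show "\<bar>r\<bar> * norm g \<le> norm (r *\<^sub>R g)"
    proof (cases "r = 0")
      case False
      have "inverse r *\<^sub>R r *\<^sub>R g = g"
        using False by (intro lhom_eqI) (simp add: scaleR_lhom.rep_eq)
      then have "norm g \<le> \<bar>inverse r\<bar> * norm (r *\<^sub>R g)"
        using norm_lhom_scaleR_le[of "inverse r" "r *\<^sub>R g"] by simp
      with False show ?thesis by (simp add: abs_inverse field_simps)
    qed (simp add: norm_lhom_nonneg)
  qed
qed

end

definition has_G_derivative ::
  "('a::real_normed_vector \<Rightarrow> 'b::real_normed_vector) \<Rightarrow> ('a, 'b) lhom \<Rightarrow> 'a set \<Rightarrow> 'a \<Rightarrow> bool"
  where "has_G_derivative f h U a \<longleftrightarrow>
    (\<forall>\<epsilon>>0. \<exists>\<eta>>0. \<forall>x\<in>U. norm (x - a) \<le> \<eta> \<longrightarrow>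
      norm (f x - f a - h (x - a)) \<le> \<epsilon> * norm (x - a))"

definition G_differentiable ::
  "('a::real_normed_vector \<Rightarrow> 'b::real_normed_vector) \<Rightarrow> 'a set \<Rightarrow> 'a \<Rightarrow> bool"
  where "G_differentiable f U a \<longleftrightarrow> (\<exists>h. has_G_derivative f h U a)"

lemma has_G_derivative_unique:
  assumes "open U" "a \<in> U" "has_G_derivative f g U a" "has_G_derivative f h U a"
  shows "g = h"
proof (rule lhom_eqI)
  fix v
  have "norm (g v - h v) \<le> e" if "e > 0" for e :: real
  proof (cases "v = 0")
    case False
    define d where "d = e / (2 * norm v)"
    have d: "d > 0" using False that by (simp add: d_def)
    obtain r where r: "r > 0" "\<forall>x\<in>U. norm (x - a) \<le> r \<longrightarrow>
        norm (f x - f a - g (x - a)) \<le> d * norm (x - a)"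
      using assms(3) d unfolding has_G_derivative_def by blast
    obtain s where s: "s > 0" "\<forall>x\<in>U. norm (x - a) \<le> s \<longrightarrow>
        norm (f x - f a - h (x - a)) \<le> d * norm (x - a)"
      using assms(4) d unfolding has_G_derivative_def by blast
    obtain q where q: "q > 0" "cball a q \<subseteq> U"
      using assms(1,2) open_contains_cball by blast
    define t where "t = min q (min r s) / norm v"
    have t: "t > 0" "t * norm v \<le> q" "t * norm v \<le> r" "t * norm v \<le> s"
      using q r s False by (auto simp: t_def)
    let ?x = "a + t *\<^sub>R v"
    have x: "?x \<in> U" using q(2) t by (auto simp: dist_norm intro!: subsetD[OF q(2)])
    have 1: "norm (f ?x - f a - t *\<^sub>R g v) \<le> d * (t * norm v)"
      using r(2)[rule_format, OF x] t by (simp add: lhom_scaleR)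
    have 2: "norm (f ?x - f a - t *\<^sub>R h v) \<le> d * (t * norm v)"
      using s(2)[rule_format, OF x] t by (simp add: lhom_scaleR)
    have "t * norm (g v - h v) = norm (t *\<^sub>R g v - t *\<^sub>R h v)"
      using t(1) by (simp flip: scaleR_diff_right)
    also have "\<dots> = norm ((f ?x - f a - t *\<^sub>R h v) - (f ?x - f a - t *\<^sub>R g v))"
      by simp
    also have "\<dots> \<le> d * (t * norm v) + d * (t * norm v)"
      using norm_triangle_ineq4 1 2 by (meson add_mono order_trans)
    also have "\<dots> = t * e" using False by (simp add: d_def)
    finally show ?thesis using t(1) by simp
  qed (use that in simp)
  then have "norm (g v - h v) \<le> 0"
    by (metis field_le_epsilon add_0)
  then show "g v = h v" by simp
qed

definition k_plus ::
  "('a::real_normed_vector \<Rightarrow> 'b::real_normed_vector) \<Rightarrow> 'a set \<Rightarrow> 'a \<Rightarrow> ('a, 'b) lhom"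
  where "k_plus f U a = (THE h. has_G_derivative f h U a)"

lemma k_plus_eqI:
  assumes "open U" "a \<in> U" "has_G_derivative f h U a"
  shows "k_plus f U a = h"
  unfolding k_plus_def using assms has_G_derivative_unique[OF assms(1,2)] by blast

text \<open>Class \<open>C\<^sup>1\<close> on an open set, with the Frechet derivative continuous for the operator norm.\<close>

definition C1_on ::
  "('a::real_normed_vector \<Rightarrow> 'b::real_normed_vector) \<Rightarrow> 'a set \<Rightarrow> bool"
  where "C1_on f U \<longleftrightarrow>
    (\<exists>f' :: 'a \<Rightarrow> 'a \<Rightarrow>\<^sub>L 'b.
      (\<forall>x\<in>U. (f has_derivative blinfun_apply (f' x)) (at x)) \<and> continuous_on U f')"

end

theory Submission
  imports Defs
begin

text \<open>Along a segment, \<open>t \<mapsto> f (x + t v) - t h\<^sub>a(v)\<close> has right derivative \<open>h\<^sub>y(v) - h\<^sub>a(v)\<close>, where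
  \<open>h\<^sub>y\<close> is the G-derivative at the current point \<open>y\<close>. By continuity of \<open>y \<mapsto> h\<^sub>y\<close> and the mean value
  inequality for right derivatives, \<open>f y - f x - h\<^sub>a(y - x)\<close> is small compared with \<open>y - x\<close> uniformly
  for \<open>x, y\<close> near \<open>a\<close>. Comparing the increments of \<open>f\<close> along \<open>a, a + t u, a + t (u + w)\<close> then shows that
  \<open>h\<^sub>a\<close> is additive, hence linear.\<close>

text \<open>The points satisfying the bound from \<open>a\<close> form a compact set, so they have a
  maximum. At a maximum below \<open>b\<close>, the right increment estimate and the triangle
  inequality would produce a larger such point.\<close>

lemma mean_value_right_increments:
  fixes \<phi> :: "real \<Rightarrow> 'b::real_normed_vector"
  assumes ab: "a \<le> b" and cont: "continuous_on {a..b} \<phi>"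
    and inc: "\<And>t. a \<le> t \<Longrightarrow> t < b \<Longrightarrow>
      \<exists>\<eta>>0. \<forall>s\<in>{t..b}. s - t \<le> \<eta> \<longrightarrow> norm (\<phi> s - \<phi> t) \<le> N * (s - t)"
  shows "norm (\<phi> b - \<phi> a) \<le> N * (b - a)"
proof -
  define S where "S = {t\<in>{a..b}. norm (\<phi> t - \<phi> a) \<le> N * (t - a)}"
  have "closed S" unfolding S_def
    by (intro continuous_on_closed_Collect_le continuous_intros cont)
  moreover have "bounded S"
    by (rule bounded_subset[of "{a..b}"]) (auto simp: S_def)
  ultimately have "compact S" by (simp add: compact_eq_bounded_closed)
  moreover have "a \<in> S" using ab by (simp add: S_def)
  ultimately obtain t where t: "t \<in> S" "\<And>s. s \<in> S \<Longrightarrow> s \<le> t"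
    using compact_attains_sup[of S] by blast
  have "t = b"
  proof (rule ccontr)
    assume "t \<noteq> b"
    with t(1) have tb: "a \<le> t" "t < b" by (auto simp: S_def)
    then obtain \<eta> where \<eta>: "\<eta> > 0"
      "\<forall>s\<in>{t..b}. s - t \<le> \<eta> \<longrightarrow> norm (\<phi> s - \<phi> t) \<le> N * (s - t)"
      using inc by blast
    \<comment> \<open>The farthest point that \<open>inc\<close> reaches from \<open>t\<close>
      without leaving the interval.\<close>
    define s where "s = min b (t + \<eta>)"
    have s: "t < s" "s \<le> b" "s - t \<le> \<eta>" using tb \<eta>(1) by (auto simp: s_def)
    have "norm (\<phi> s - \<phi> a) \<le> norm (\<phi> s - \<phi> t) + norm (\<phi> t - \<phi> a)"
      using norm_triangle_ineq[of "\<phi> s - \<phi> t" "\<phi> t - \<phi> a"] by simp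
    also have "\<dots> \<le> N * (s - t) + N * (t - a)"
      using \<eta>(2) s t(1) by (intro add_mono) (auto simp: S_def)
    also have "\<dots> = N * (s - a)" by (simp add: algebra_simps)
    finally have "s \<in> S" using s tb by (simp add: S_def)
    with t(2) s show False by fastforce
  qed
  with t(1) show ?thesis by (simp add: S_def)
qed

text \<open>Tolerance 1 in the definition bounds the increments at \<open>a\<close> by
  \<open>(1 + norm h) * norm (x - a)\<close>, which tends to 0.\<close>

lemma G_differentiable_continuous_on:
  assumes "\<And>x. x \<in> U \<Longrightarrow> G_differentiable f U x"
  shows "continuous_on U f"
  unfolding continuous_on_def
proof
  fix a assume a: "a \<in> U"
  obtain h where "has_G_derivative f h U a"
    using assms[OF a] by (auto simp: G_differentiable_def)
  then obtain \<eta> where \<eta>: "\<eta> > 0" "\<forall>x\<in>U. norm (x - a) \<le> \<eta> \<longrightarrow>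
      norm (f x - f a - h (x - a)) \<le> 1 * norm (x - a)"
    unfolding has_G_derivative_def using zero_less_one by blast
  have "norm (f x - f a) \<le> (1 + norm h) * norm (x - a)"
    if "x \<in> U" "norm (x - a) \<le> \<eta>" for x
  proof -
    have "norm (f x - f a) \<le> norm (f x - f a - h (x - a)) + norm (h (x - a))"
      using norm_triangle_ineq[of "f x - f a - h (x - a)" "h (x - a)"] by simp
    then show ?thesis
      using \<eta>(2)[rule_format, OF that] norm_lhom_apply[of h "x - a"] by (simp add: distrib_right)
  qed
  then have "\<forall>\<^sub>F x in at a within U. norm (f x - f a) \<le> (1 + norm h) * norm (x - a)"
    using \<eta>(1) by (auto simp: eventually_at dist_norm intro!: exI[of _ \<eta>])
  moreover have "((\<lambda>x. (1 + norm h) * norm (x - a)) \<longlongrightarrow> 0) (at a within U)"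
    by (auto intro!: tendsto_eq_intros)
  ultimately have "((\<lambda>x. f x - f a) \<longlongrightarrow> 0) (at a within U)"
    by (rule Lim_null_comparison)
  then show "(f \<longlongrightarrow> f a) (at a within U)" by (rule LIM_zero_cancel)
qed

text \<open>The mean value inequality is applied to \<phi>, the restriction of \<open>f\<close> to
  the segment minus \<open>t *\<^sub>R h v\<close>. The gap between \<open>c\<close> and
  \<open>e\<close> absorbs the error of the tangent approximation at each point.\<close>

lemma G_derivative_mean_value:
  fixes f :: "'a::real_normed_vector \<Rightarrow> 'b::real_normed_vector"
  assumes seg: "closed_segment x y \<subseteq> U"
    and deriv: "\<And>z. z \<in> U \<Longrightarrow> has_G_derivative f (k z) U z"
    and bound: "\<And>z. z \<in> closed_segment x y \<Longrightarrow> norm (k z - h) \<le> c"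
    and "c < e"
  shows "norm (f y - f x - h (y - x)) \<le> e * norm (y - x)"
proof (cases "x = y")
  case False
  define v where "v = y - x"
  define \<phi> where "\<phi> t = f (x + t *\<^sub>R v) - t *\<^sub>R h v" for t :: real
  have v: "norm v > 0" using False by (simp add: v_def)
  have in_seg: "x + t *\<^sub>R v \<in> closed_segment x y" if "t \<in> {0..1}" for t
    using that by (auto simp: in_segment v_def algebra_simps intro!: exI[of _ t])
  have "continuous_on U f"
    by (rule G_differentiable_continuous_on) (use deriv in \<open>auto simp: G_differentiable_def\<close>)
  moreover have "continuous_on {0..1} (\<lambda>t. x + t *\<^sub>R v)" by (intro continuous_intros)
  moreover have "(\<lambda>t. x + t *\<^sub>R v) ` {0..1} \<subseteq> U" using in_seg seg by blast
  ultimately have "continuous_on {0..1} (\<lambda>t. f (x + t *\<^sub>R v))" by (rule continuous_on_compose2)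
  then have "continuous_on {0..1} \<phi>" unfolding \<phi>_def
    by (intro continuous_on_diff continuous_on_scaleR continuous_on_id continuous_on_const)
  moreover have "\<exists>\<eta>>0. \<forall>s\<in>{t..1}. s - t \<le> \<eta> \<longrightarrow> norm (\<phi> s - \<phi> t) \<le> (e * norm v) * (s - t)"
    if t: "0 \<le> t" "t < 1" for t
  proof -
    define z where "z = x + t *\<^sub>R v"
    have z: "z \<in> closed_segment x y" "z \<in> U" using in_seg[of t] seg t by (auto simp: z_def)
    obtain r where r: "r > 0" "\<forall>x\<in>U. norm (x - z) \<le> r \<longrightarrow>
        norm (f x - f z - k z (x - z)) \<le> (e - c) * norm (x - z)"
      using deriv[OF z(2)] \<open>c < e\<close> unfolding has_G_derivative_def by (meson diff_gt_0_iff_gt)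
    have "norm (\<phi> s - \<phi> t) \<le> (e * norm v) * (s - t)" if s: "s \<in> {t..1}" "s - t \<le> r / norm v" for s
    proof -
      define w where "w = x + s *\<^sub>R v"
      have w: "w \<in> U" "w - z = (s - t) *\<^sub>R v"
        using in_seg[of s] seg t s(1) by (auto simp: w_def z_def algebra_simps)
      have nw: "norm (w - z) = (s - t) * norm v" using s by (simp add: w)
      have "norm (w - z) \<le> r" using s(2) v by (simp add: nw pos_le_divide_eq)
      then have 1: "norm (f w - f z - k z (w - z)) \<le> (e - c) * norm (w - z)"
        using r w by blast
      have 2: "norm ((k z - h) (w - z)) \<le> c * norm (w - z)"
        using norm_lhom_apply[of "k z - h" "w - z"] bound[OF z(1)]
        by (meson mult_right_mono norm_ge_zero order_trans)
      \<comment> \<open>Positive homogeneity gives this because \<open>s - t\<close> is nonnegative;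
        this is why only right increments are estimated.\<close>
      have "h (w - z) = s *\<^sub>R h v - t *\<^sub>R h v"
        using s lhom_scaleR[of "s - t" h v] by (simp add: w(2) scaleR_diff_left)
      \<comment> \<open>The first summand is the tangency error at \<open>z\<close>, with share
        \<open>e - c\<close>; the second measures how far \<open>k z\<close> is from
        \<open>h\<close>, with share \<open>c\<close>.\<close>
      then have "\<phi> s - \<phi> t = (f w - f z - k z (w - z)) + (k z - h) (w - z)"
        by (simp add: \<phi>_def w_def z_def minus_lhom.rep_eq)
      then have "norm (\<phi> s - \<phi> t) \<le> (e - c) * norm (w - z) + c * norm (w - z)"
        using 1 2 norm_triangle_mono by metis
      then show ?thesis by (simp add: nw algebra_simps)
    qed
    then show ?thesis using r(1) v by (intro exI[of _ "r / norm v"]) auto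
  qed
  ultimately have "norm (\<phi> 1 - \<phi> 0) \<le> (e * norm v) * (1 - 0)"
    by (intro mean_value_right_increments) auto
  then show ?thesis by (simp add: \<phi>_def v_def algebra_simps)
qed simp

text \<open>This is strict differentiability at \<open>a\<close>: both end points may vary. Balls
  are convex, so on a small one every segment stays where \<open>k z\<close> is within
  \<open>e / 2\<close> of \<open>k a\<close>, and the mean value estimate applies with
  \<open>c = e / 2\<close>.\<close>

lemma continuous_G_derivative_strict:
  fixes f :: "'a::real_normed_vector \<Rightarrow> 'b::real_normed_vector"
  assumes "open U" "a \<in> U" and deriv: "\<And>z. z \<in> U \<Longrightarrow> has_G_derivative f (k z) U z"
    and cont: "continuous_on U k" and "e > 0"
  obtains d where "d > 0"
    "\<And>x y. x \<in> ball a d \<Longrightarrow> y \<in> ball a d \<Longrightarrow> norm (f y - f x - k a (y - x)) \<le> e * norm (y - x)"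
proof -
  obtain r where r: "r > 0" "ball a r \<subseteq> U" using assms(1,2) open_contains_ball by blast
  obtain s where s: "s > 0" "\<And>z. z \<in> U \<Longrightarrow> dist z a < s \<Longrightarrow> dist (k z) (k a) < e / 2"
    using cont \<open>a \<in> U\<close> \<open>e > 0\<close> unfolding continuous_on_iff by (meson half_gt_zero)
  define d where "d = min r s"
  have sub: "ball a d \<subseteq> U" using r by (auto simp: d_def)
  have "norm (f y - f x - k a (y - x)) \<le> e * norm (y - x)"
    if "x \<in> ball a d" "y \<in> ball a d" for x y
  proof (rule G_derivative_mean_value[where U = U and k = k and c = "e / 2"])
    have seg: "closed_segment x y \<subseteq> ball a d"
      by (rule closed_segment_subset) (use that in auto)
    then show "closed_segment x y \<subseteq> U" using sub by blast
    show "norm (k z - k a) \<le> e / 2" if "z \<in> closed_segment x y" for z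
      using s(2)[of z] seg sub that by (auto simp: d_def dist_norm norm_minus_commute less_imp_le
          subset_iff)
  qed (use deriv \<open>e > 0\<close> in auto)
  then show thesis using that[of d] r(1) s(1) by (simp add: d_def)
qed

text \<open>The increment of \<open>f\<close> from \<open>a\<close> to
  \<open>a + t *\<^sub>R (u + w)\<close> is the sum of those through
  \<open>a + t *\<^sub>R u\<close>. Replacing each by its approximation through \<open>k a\<close>
  and dividing by \<open>t\<close> leaves a defect of at most \<open>e * C\<close>, for every
  \<open>e > 0\<close>.\<close>

lemma continuous_G_derivative_add:
  fixes f :: "'a::real_normed_vector \<Rightarrow> 'b::real_normed_vector"
  assumes "open U" "a \<in> U" "\<And>z. z \<in> U \<Longrightarrow> has_G_derivative f (k z) U z" "continuous_on U k"
  shows "k a (u + w) = k a u + k a w"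
proof -
  define C where "C = norm (u + w) + norm u + norm w"
  have C: "C \<ge> 0" by (simp add: C_def)
  have small: "norm (k a (u + w) - k a u - k a w) \<le> e * C" if "e > 0" for e :: real
  proof -
    obtain d where d: "d > 0"
      "\<And>x y. x \<in> ball a d \<Longrightarrow> y \<in> ball a d \<Longrightarrow> norm (f y - f x - k a (y - x)) \<le> e * norm (y - x)"
      by (rule continuous_G_derivative_strict[OF assms \<open>e > 0\<close>]) blast+
    \<comment> \<open>Small enough to keep all three points in the ball; adding 1 covers the case
      \<open>C = 0\<close>.\<close>
    define t where "t = d / (1 + C)"
    have t: "t > 0" using d(1) C by (simp add: t_def)
    have tC: "t * C < d" using d(1) C by (simp add: t_def field_simps)
    have in_ball: "a + t *\<^sub>R p \<in> ball a d" if "norm p \<le> C" for p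
    proof -
      have "t * norm p < d" using mult_left_mono[OF that, of t] tC t by linarith
      then show ?thesis using t by (simp add: dist_norm)
    qed
    let ?x = "a + t *\<^sub>R u" and ?y = "a + t *\<^sub>R (u + w)"
    have balls: "a \<in> ball a d" "?x \<in> ball a d" "?y \<in> ball a d"
      using d(1) in_ball[of u] in_ball[of "u + w"] by (simp_all add: C_def)
    have 1: "norm (f ?y - f a - t *\<^sub>R k a (u + w)) \<le> e * (t * norm (u + w))"
      using d(2)[OF balls(1,3)] t by (simp add: lhom_scaleR)
    have 2: "norm (f ?x - f a - t *\<^sub>R k a u) \<le> e * (t * norm u)"
      using d(2)[OF balls(1,2)] t by (simp add: lhom_scaleR)
    \<comment> \<open>This increment starts at \<open>?x\<close> rather than \<open>a\<close>, so
      tangency at \<open>a\<close> alone would not control it; the strict estimate does.\<close>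
    have "?y - ?x = t *\<^sub>R w" by (simp add: algebra_simps)
    then have 3: "norm (f ?y - f ?x - t *\<^sub>R k a w) \<le> e * (t * norm w)"
      using d(2)[OF balls(2,3)] t by (simp add: lhom_scaleR)
    have "t *\<^sub>R (k a (u + w) - k a u - k a w) = (f ?x - f a - t *\<^sub>R k a u)
        + (f ?y - f ?x - t *\<^sub>R k a w) - (f ?y - f a - t *\<^sub>R k a (u + w))"
      by (simp add: algebra_simps)
    then have "norm (t *\<^sub>R (k a (u + w) - k a u - k a w))
        \<le> e * (t * norm u) + e * (t * norm w) + e * (t * norm (u + w))"
      using 1 2 3 by (metis add_mono norm_triangle_le norm_triangle_le_diff)
    also have "\<dots> = t * (e * C)" by (simp add: C_def algebra_simps)
    finally show ?thesis using t by simp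
  qed
  have "norm (k a (u + w) - k a u - k a w) \<le> 0 + e" if "e > 0" for e :: real
  proof -
    have "e / (1 + C) * C \<le> e" using that C by (simp add: field_simps)
    then show ?thesis using small[of "e / (1 + C)"] that C by simp
  qed
  then have "norm (k a (u + w) - k a u - k a w) \<le> 0" by (rule field_le_epsilon)
  then show ?thesis by (simp add: algebra_simps)
qed

text \<open>Additivity makes \<open>h\<close> odd, which extends homogeneity to negative scalars;
  \<open>norm h\<close> serves as the bound.\<close>

lemma lhom_bounded_linearI:
  assumes add: "\<And>x y. lhom_apply h (x + y) = h x + h y"
  shows "bounded_linear (lhom_apply h)"
proof (rule bounded_linear_intro[where K = "norm h"])
  show "h (r *\<^sub>R x) = r *\<^sub>R h x" for r x
  proof (cases "r \<ge> 0")
    case False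
    have "h (r *\<^sub>R x) + h ((- r) *\<^sub>R x) = 0" by (simp flip: add)
    with False show ?thesis using lhom_scaleR[of "- r" h x]
      by (metis add_eq_0_iff2 minus_minus neg_0_le_iff_le nle_le scaleR_minus_left)
  qed (rule lhom_scaleR)
qed (use add norm_lhom_apply[of h] in \<open>auto simp: mult.commute\<close>)

theorem theorem2p4p14:
  fixes f :: "'a::real_normed_vector \<Rightarrow> 'b::real_normed_vector"
    and U :: "'a set" and U' :: "'b set"
  assumes "\<exists>B :: 'a set. finite B \<and> span B = UNIV"
    and "\<exists>B :: 'b set. finite B \<and> span B = UNIV"
    and "open U" and "open U'"
    and "f ` U \<subseteq> U'"
    and "\<And>x. x \<in> U \<Longrightarrow> G_differentiable f U x"
    and "continuous_on U (k_plus f U)"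
  shows "C1_on f U"
proof -
  let ?k = "k_plus f U"
  have deriv: "has_G_derivative f (?k x) U x" if "x \<in> U" for x
    using assms(6)[OF that] k_plus_eqI[OF \<open>open U\<close> that] by (auto simp: G_differentiable_def)
  \<comment> \<open>\<open>Blinfun\<close> is meaningful only at bounded linear arguments, so
    \<open>f'\<close> is evaluated through \<open>lin\<close>, at points of
    \<open>U\<close>.\<close>
  define f' where "f' x = Blinfun (lhom_apply (?k x))" for x
  have lin: "bounded_linear (lhom_apply (?k x))" if "x \<in> U" for x
    using continuous_G_derivative_add[OF \<open>open U\<close> that deriv assms(7)]
    by (intro lhom_bounded_linearI) auto
  have f': "blinfun_apply (f' x) = lhom_apply (?k x)" if "x \<in> U" for x
    using lin[OF that] by (simp add: f'_def bounded_linear_Blinfun_apply)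
  have "(f has_derivative blinfun_apply (f' x)) (at x)" if x: "x \<in> U" for x
  proof -
    have "(f has_derivative lhom_apply (?k x)) (at x within U)"
      unfolding has_derivative_within_alt2
    proof (intro conjI allI impI lin[OF x])
      fix e :: real assume "e > 0"
      then obtain \<eta> where "\<eta> > 0" "\<forall>y\<in>U. norm (y - x) \<le> \<eta> \<longrightarrow>
          norm (f y - f x - ?k x (y - x)) \<le> e * norm (y - x)"
        using deriv[OF x] unfolding has_G_derivative_def by blast
      then show "\<forall>\<^sub>F y in at x within U. norm (f y - f x - ?k x (y - x)) \<le> e * norm (y - x)"
        by (auto simp: eventually_at dist_norm intro!: exI[of _ \<eta>])
    qed
    then show ?thesis using at_within_open[OF x \<open>open U\<close>] f'[OF x] by simp
  qed
  \<comment> \<open>Passing from the norm of \<open>lhom\<close> to the operator norm does not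
    increase distances, so continuity of \<open>?k\<close> carries over to
    \<open>f'\<close>.\<close>
  moreover have "dist (f' x) (f' y) \<le> dist (?k x) (?k y)" if "x \<in> U" "y \<in> U" for x y
    unfolding dist_norm
  proof (rule norm_blinfun_bound)
    show "norm (blinfun_apply (f' x - f' y) v) \<le> norm (?k x - ?k y) * norm v" for v
      using norm_lhom_apply[of "?k x - ?k y" v] that
      by (simp add: blinfun.diff_left f' minus_lhom.rep_eq)
  qed simp
  then have "continuous_on U f'"
    using assms(7) unfolding continuous_on_iff by (meson le_less_trans)
  ultimately show ?thesis unfolding C1_on_def by blast
qed

end
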